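(* Let $S=\langle L,\leq,\top,\bot,\Box,\boxtimes\rangle$ be a meet APS such that for all $x,y,z\in L$, if $x\leq\Box y$ and $x\leq\boxtimes(y\land z)$, then $x\leq\boxtimes z$. Let $\triangle v$ be a one-variable APS term (built from $v$ using only $\Box$ and $\boxtimes$). Then: (1) If $d(\triangle)$ is even, then $\mathsf{E}_S(\triangle)$ holds. (2) If $d(\triangle)$ is odd, then $\mathsf{E}_S(\triangle)$ holds if and only if $\mathsf{E}_S(\boxtimes)$ holds.
   Context: An abstract provability structure (APS) is a tuple $S=\langle L,\leq,\top,\bot,\Box,\boxtimes\rangle$ where $L$ is a nonempty set, $\leq$ is a partial order on $L$, $\top,\bot\in L$, and $\Box,\boxtimes$ are unary operations on $L$ such that for all $x,y\in L$: (C1) if $x\leq y$ then $\Box x\leq\Box y$ and $\boxtimes y\leq\boxtimes x$; (C2) $\top\leq\boxtimes\bot$; (C3) if $x\leq\Box y$ and $x\leq\boxtimes y$ then $x\leq\boxtimes\top$; (C4) $\boxtimes x\leq\Box\boxtimes x$; (C5) $x\leq\top$. (It is not assumed that $\bot$ is the least element.) A meet APS is an APS for which $\langle L,\leq\rangle$ is a meet-semilattice; $x\land y$ denotes the meet. A one-variable APS term $\triangle v$ is generated from the variable $v$ by finitely many applications of $\Box$ and $\boxtimes$ (no $\land$); it induces a unary operation $x\mapsto\triangle x$ on $L$. The degree $d(\triangle)$ is the number of occurrences of $\boxtimes$ in $\triangle$. $\mathsf{E}_S(\triangle)$ means "$\triangle v$ has a fixed point in $S$", i.e. there is $p\in L$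 with $\triangle p=p$; in particular $\mathsf{E}_S(\boxtimes)$ means there is $p\in L$ with $p=\boxtimes p$. *)

theory Defs
  imports Main
begin

text \<open>
  An abstract provability structure. The set \<open>L\<close> is the whole (nonempty) type \<open>'a\<close>, and its partial
  order is that of the type class. The parameters \<open>tp\<close>, \<open>bt\<close>, \<open>bx\<close>, \<open>rf\<close> stand for top, bottom, box
  and crossed box (boxtimes). They are explicit because \<open>bt\<close> need not be the least element.
\<close>

locale aps =
  fixes tp bt :: "'a::order" and bx rf :: "'a \<Rightarrow> 'a"
  assumes C1: "x \<le> y \<Longrightarrow> bx x \<le> bx y \<and> rf y \<le> rf x"
    and C2: "tp \<le> rf bt"
    and C3: "x \<le> bx y \<Longrightarrow> x \<le> rf y \<Longrightarrow> x \<le> rf tp"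
    and C4: "rf x \<le> bx (rf x)"
    and C5: "x \<le> tp"

text \<open>The class \<^class>\<open>semilattice_inf\<close> only asserts that the order has binary meets.\<close>

locale meet_aps = aps tp bt bx rf
  for tp bt :: "'a::semilattice_inf" and bx rf :: "'a \<Rightarrow> 'a"

datatype aps_term = Var | Box aps_term | Boxtimes aps_term

primrec degree :: "aps_term \<Rightarrow> nat" where
  "degree Var = 0"
| "degree (Box t) = degree t"
| "degree (Boxtimes t) = Suc (degree t)"

primrec eval_term :: "('a \<Rightarrow> 'a) \<Rightarrow> ('a \<Rightarrow> 'a) \<Rightarrow> aps_term \<Rightarrow> 'a \<Rightarrow> 'a" where
  "eval_term bx rf Var x = x"
| "eval_term bx rf (Box t) x = bx (eval_term bx rf t x)"
| "eval_term bx rf (Boxtimes t) x = rf (eval_term bx rf t x)"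

definition has_fixed_point :: "('a \<Rightarrow> 'a) \<Rightarrow> ('a \<Rightarrow> 'a) \<Rightarrow> aps_term \<Rightarrow> bool" where
  "has_fixed_point bx rf t \<longleftrightarrow> (\<exists>p. eval_term bx rf t p = p)"

end

theory Submission
  imports Defs
begin

text \<open>
  Put \<open>f = rf tp\<close>, the least value of \<open>rf\<close>. Call \<open>y\<close> sound if \<open>f \<le> y \<le> bx y\<close>; every value of
  \<open>rf\<close> is sound. For sound \<open>y\<close> the meet of \<open>rf y\<close> and \<open>bx y\<close> lies below \<open>f \<le> y\<close>, so the extra
  hypothesis yields \<open>rf (bx y) = rf y\<close>. Hence boxes are invisible to \<open>rf\<close>, and a term of degree
  \<open>d > 0\<close> has a fixed point iff the iterate \<open>rf\<^sup>d\<close> has one. The same cancellation gives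
  \<open>rf\<^sup>2 y \<le> rf\<^sup>4 y\<close>. As \<open>rf f\<close> is the largest value of \<open>rf\<^sup>2\<close>, it is fixed by \<open>rf\<^sup>2\<close>, which settles
  the even case for \<open>d > 0\<close> (in degree 0, \<open>tp = rf bt\<close> is fixed by \<open>bx\<close>); for odd \<open>d\<close>, a fixed point \<open>p\<close> of \<open>rf\<^sup>d\<close> satisfies \<open>p \<le> rf\<^sup>2 p \<le> \<dots> \<le> rf\<^sup>2\<^sup>d p = p\<close>,
  so \<open>p\<close> is fixed by \<open>rf\<^sup>2\<close> and therefore by \<open>rf\<close>.
\<close>

locale cancellative_meet_aps = meet_aps +
  assumes rf_inf_cancel: "x \<le> bx y \<Longrightarrow> x \<le> rf (inf y z) \<Longrightarrow> x \<le> rf z"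
begin

definition sound :: "'a \<Rightarrow> bool" where
  "sound y \<longleftrightarrow> rf tp \<le> y \<and> y \<le> bx y"

lemma bx_mono: "x \<le> y \<Longrightarrow> bx x \<le> bx y"
  using C1 by blast

lemma rf_antimono: "x \<le> y \<Longrightarrow> rf y \<le> rf x"
  using C1 by blast

lemma rf_tp_le: "rf tp \<le> rf x"
  using C5 rf_antimono by blast

lemma inf_bx_rf_le: "inf (bx y) (rf y) \<le> rf tp"
  by (rule C3[of _ y]) simp_all

lemma sound_rf: "sound (rf y)"
  using rf_tp_le C4 by (simp add: sound_def)

lemma sound_bx: "sound y \<Longrightarrow> sound (bx y)"
  using bx_mono[of y "bx y"] by (auto simp: sound_def)

lemma rf_bx:
  assumes "sound y"
  shows "rf (bx y) = rf y"
proof (rule antisym)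
  show "rf (bx y) \<le> rf y"
    using assms rf_antimono by (simp add: sound_def)
  \<comment> \<open>With \<open>rf y\<close> in place of \<open>x\<close> and \<open>y\<close> and
    \<open>bx y\<close> in place of \<open>z\<close> in \<open>rf_inf_cancel\<close>, C4 is its
    first premise; this bound gives the second.\<close>
  have "inf (rf y) (bx y) \<le> y"
    using inf_bx_rf_le[of y] assms order_trans by (auto simp: sound_def inf_commute)
  then show "rf y \<le> rf (bx y)"
    using rf_antimono rf_inf_cancel[OF C4] by blast
qed

lemma sound_eval: "sound y \<Longrightarrow> sound (eval_term bx rf t y)"
  by (induction t) (auto intro: sound_rf sound_bx)

lemma sound_eval_degree_pos: "degree t > 0 \<Longrightarrow> sound (eval_term bx rf t y)"
  by (induction t) (auto intro: sound_rf sound_bx)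

lemma rf_eval: "sound y \<Longrightarrow> rf (eval_term bx rf t y) = (rf ^^ degree t) (rf y)"
  by (induction t) (simp_all add: rf_bx sound_eval)

text \<open>The outermost \<open>Boxtimes\<close> sees its argument only through \<open>rf\<close>,
  hence by \<open>rf_eval\<close> only the \<open>rf\<close>-value of the input.\<close>

lemma eval_cong:
  assumes "sound y" "sound z" "rf y = rf z"
  shows "degree t > 0 \<Longrightarrow> eval_term bx rf t y = eval_term bx rf t z"
  by (induction t) (simp_all add: rf_eval assms)

lemma has_fixed_point_iff_funpow:
  assumes "degree t > 0"
  shows "has_fixed_point bx rf t \<longleftrightarrow> (\<exists>q. (rf ^^ degree t) q = q)"
proof
  assume "has_fixed_point bx rf t"
  then obtain p where p: "eval_term bx rf t p = p"
    by (auto simp: has_fixed_point_def)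
  then have "sound p"
    using sound_eval_degree_pos[OF assms, of p] by simp
  then have "(rf ^^ degree t) (rf p) = rf p"
    using rf_eval[of p t] p by simp
  then show "\<exists>q. (rf ^^ degree t) q = q" by blast
next
  assume "\<exists>q. (rf ^^ degree t) q = q"
  then obtain q where q: "(rf ^^ degree t) q = q" by blast
  obtain d where "degree t = Suc d"
    using assms gr0_implies_Suc by blast
  then have sq: "sound q"
    using q sound_rf[of "(rf ^^ d) q"] by simp
  \<comment> \<open>\<open>q\<close> itself need not be fixed, but \<open>r\<close> is sound and has
    the same \<open>rf\<close>-value.\<close>
  define r where "r = eval_term bx rf t q"
  have "rf r = rf q"
    using rf_eval[OF sq] q by (simp add: r_def flip: funpow_swap1)
  then have "eval_term bx rf t r = r"
    using eval_cong[OF _ sq _ assms] sound_eval[OF sq] by (simp add: r_def)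
  then show "has_fixed_point bx rf t"
    by (auto simp: has_fixed_point_def)
qed

lemma rf_rf_le: "rf (rf y) \<le> rf (rf tp)"
  using rf_antimono rf_tp_le by blast

lemma rf2_le_rf4: "rf (rf y) \<le> rf (rf (rf (rf y)))"
proof (rule rf_inf_cancel[OF C4])
  have "inf (rf (rf y)) (rf (rf (rf y))) \<le> rf tp"
    by (rule C3[OF le_infI1[OF C4] inf_le2])
  then show "rf (rf y) \<le> rf (inf (rf (rf y)) (rf (rf (rf y))))"
    using rf_antimono rf_rf_le order_trans by blast
qed

lemma rf2_fixed: "rf (rf (rf (rf tp))) = rf (rf tp)"
  using rf2_le_rf4 rf_rf_le antisym by blast

lemma funpow_rf_even_fixed: "even d \<Longrightarrow> (rf ^^ d) (rf (rf tp)) = rf (rf tp)"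
proof (elim evenE)
  fix k assume "d = 2 * k"
  moreover have "(rf ^^ (2 * k)) (rf (rf tp)) = rf (rf tp)"
    by (induction k) (simp_all add: rf2_fixed)
  ultimately show ?thesis by simp
qed

lemma funpow_rf_odd_fixed:
  assumes "odd d" and q: "(rf ^^ d) q = q"
  shows "rf q = q"
proof -
  obtain k where d: "d = Suc (2 * k)"
    using assms(1) by (auto elim: oddE)
  \<comment> \<open>Doubling makes the exponent at least 2 even for \<open>d = 1\<close>, so
    \<open>q\<close> is a value of \<open>rf\<close> applied twice and \<open>rf2_le_rf4\<close>
    starts the chain at \<open>q\<close>.\<close>
  have "(rf ^^ (d + d)) q = q"
    by (simp only: funpow_add o_apply q)
  moreover have "d + d = Suc (Suc (4 * k))"
    using d by simp
  ultimately have q2: "rf (rf ((rf ^^ (4 * k)) q)) = q"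
    by simp
  have step: "(rf ^^ (2 * n)) q \<le> (rf ^^ (2 * Suc n)) q" for n
  proof (induction n)
    case 0
    show ?case
      using rf2_le_rf4[of "(rf ^^ (4 * k)) q"] by (simp add: q2 numeral_2_eq_2)
  next
    case (Suc n)
    then show ?case
      by (simp add: rf_antimono)
  qed
  have "(rf ^^ (2 * m)) q \<le> (rf ^^ (2 * n)) q" if "m \<le> n" for m n
    using lift_Suc_mono_le[of "\<lambda>n. (rf ^^ (2 * n)) q", OF step that] .
  moreover have "Suc 0 \<le> d"
    using d by simp
  ultimately have "(rf ^^ (2 * Suc 0)) q \<le> (rf ^^ (2 * d)) q" by blast
  then have "rf (rf q) \<le> q"
    by (simp add: mult_2 numeral_2_eq_2 \<open>(rf ^^ (d + d)) q = q\<close>)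
  moreover from step[of 0] have "q \<le> rf (rf q)"
    by (simp add: numeral_2_eq_2)
  ultimately have "rf (rf q) = q" by (rule antisym)
  then have "(rf ^^ (2 * k)) q = q"
    by (induction k) simp_all
  then show ?thesis
    using q d by simp
qed

lemma bx_tp: "bx tp = tp"
proof (rule antisym[OF C5])
  have "rf bt = tp"
    using C2 C5 antisym by blast
  then show "tp \<le> bx tp"
    using C4[of bt] by simp
qed

lemma eval_tp: "degree t = 0 \<Longrightarrow> eval_term bx rf t tp = tp"
  by (induction t) (simp_all add: bx_tp)

lemma has_fixed_point_even: "even (degree t) \<Longrightarrow> has_fixed_point bx rf t"
  using eval_tp[of t] has_fixed_point_iff_funpow[of t] funpow_rf_even_fixed[of "degree t"]
  unfolding has_fixed_point_def by blast

lemma has_fixed_point_odd: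
  assumes "odd (degree t)"
  shows "has_fixed_point bx rf t \<longleftrightarrow> has_fixed_point bx rf (Boxtimes Var)"
proof -
  have "(rf ^^ n) q = q" if "rf q = q" for n q
    by (induction n) (simp_all add: that)
  moreover have "has_fixed_point bx rf (Boxtimes Var) \<longleftrightarrow> (\<exists>q. rf q = q)"
    by (simp add: has_fixed_point_def)
  ultimately show ?thesis
    using has_fixed_point_iff_funpow[OF odd_pos[OF assms]] funpow_rf_odd_fixed[OF assms]
    by blast
qed

end

theorem theorem7p4:
  fixes tp bt :: "'a::semilattice_inf"
    and bx rf :: "'a \<Rightarrow> 'a"
    and t :: aps_term
  assumes "meet_aps tp bt bx rf"
    and "\<And>x y z. x \<le> bx y \<Longrightarrow> x \<le> rf (inf y z) \<Longrightarrow> x \<le> rf z"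
  shows "(even (degree t) \<longrightarrow> has_fixed_point bx rf t) \<and>
         (odd (degree t) \<longrightarrow>
            (has_fixed_point bx rf t \<longleftrightarrow> has_fixed_point bx rf (Boxtimes Var)))"
proof -
  interpret cancellative_meet_aps tp bt bx rf
    using assms by (rule cancellative_meet_aps.intro[OF _ cancellative_meet_aps_axioms.intro])
  show ?thesis
    using has_fixed_point_even has_fixed_point_odd by blast
qed

end
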